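(* Let $p,q$ be positive integers and let $\mathbf{a}=(a_{ij})_{1\le i\le p,\,1\le j\le q}$ and $\mathbf{u}=(u_{ij})_{1\le i\le p,\,1\le j\le q}$ be two double sequences of real numbers such that $$a_{ij}\geq 0,\qquad \Delta_{ij}\geq 0\qquad\text{and}\qquad \sum_{k=1}^{i}\sum_{l=1}^{j}u_{kl}\geq 0$$ for all $i\in\{1,2,\dots,p\}$ and $j\in\{1,2,\dots,q\}$ (the condition on $\Delta_{ij}$ being required for all $(i,j)$ for which $\Delta_{ij}$ is defined, i.e. $(i,j)\neq(p,q)$). Then $$\sum_{i=1}^{p}\sum_{j=1}^{q}a_{ij}u_{ij}\geq 0.$$
   Context: For a double sequence $(a_{ij})_{1\le i\le p,\,1\le j\le q}$ of real numbers, define $$\Delta_{ij}=\begin{cases} a_{i,j}-a_{i+1,j}-a_{i,j+1}+a_{i+1,j+1} & \text{if } 1\leq i<p,\ 1\leq j<q,\\ a_{i,q}-a_{i+1,q} & \text{if } 1\leq i<p,\ j=q,\\ a_{p,j}-a_{p,j+1} & \text{if } i=p,\ 1\leq j<q.\end{cases}$$ $\Delta_{pq}$ is not defined. *)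

theory Defs
  imports Complex_Main
begin

text \<open>
  A double sequence is a function on pairs of naturals of which only the values at
  \<open>1 \<le> i \<le> p\<close>, \<open>1 \<le> j \<le> q\<close> matter. The last branch covers \<open>(p, q)\<close> and indices out of
  range, where the difference has no meaning.
\<close>

definition Delta :: "nat \<Rightarrow> nat \<Rightarrow> (nat \<Rightarrow> nat \<Rightarrow> real) \<Rightarrow> nat \<Rightarrow> nat \<Rightarrow> real" where
  "Delta p q a i j =
    (if 1 \<le> i \<and> i < p \<and> 1 \<le> j \<and> j < q
       then a i j - a (i + 1) j - a i (j + 1) + a (i + 1) (j + 1)
     else if 1 \<le> i \<and> i < p \<and> j = q then a i q - a (i + 1) q
     else if i = p \<and> 1 \<le> j \<and> j < q then a p j - a p (j + 1)
     else undefined)"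

end

(* Extended by zero outside the p x q rectangle, the array a has all second differences nonnegative:
   Delta i j is the second difference at (i, j), also on the boundary, and at (p, q) it is a p q.
   Summation by parts in both indices then turns the sum of a i j * u i j into the sum of these
   second differences times the rectangular partial sums of u. *)
theory Submission
  imports Defs
begin

text \<open>Abel summation. The last difference is \<open>f n - f (n + 1)\<close>, so the boundary
  term carries \<open>f (n + 1)\<close> and drops out when \<open>f\<close> is zero at
  \<open>n + 1\<close>.\<close>

lemma sum_by_parts:
  fixes f x :: "nat \<Rightarrow> 'a::comm_ring"
  shows "(\<Sum>i=1..n. f i * x i) =
    (\<Sum>i=1..n. (f i - f (i + 1)) * (\<Sum>k=1..i. x k)) + f (n + 1) * (\<Sum>k=1..n. x k)"
  by (induction n) (simp_all add: algebra_simps)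

text \<open>Abel summation in \<open>j\<close> for each fixed \<open>i\<close>, then in
  \<open>i\<close> for each fixed \<open>j\<close>; the zeros in row \<open>p + 1\<close> and column
  \<open>q + 1\<close> remove the boundary terms.\<close>

lemma double_sum_by_parts:
  fixes b u :: "nat \<Rightarrow> nat \<Rightarrow> 'a::comm_ring"
  assumes "\<And>j. b (p + 1) j = 0" and "\<And>i. b i (q + 1) = 0"
  shows "(\<Sum>i=1..p. \<Sum>j=1..q. b i j * u i j) =
    (\<Sum>i=1..p. \<Sum>j=1..q. (b i j - b (i + 1) j - b i (j + 1) + b (i + 1) (j + 1)) *
      (\<Sum>k=1..i. \<Sum>l=1..j. u k l))"
proof -
  have "(\<Sum>i=1..p. \<Sum>j=1..q. b i j * u i j) =
      (\<Sum>i=1..p. \<Sum>j=1..q. (b i j - b i (j + 1)) * (\<Sum>l=1..j. u i l))"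
    using assms(2) by (subst sum_by_parts) simp
  also have "\<dots> = (\<Sum>j=1..q. \<Sum>i=1..p. (b i j - b i (j + 1)) * (\<Sum>l=1..j. u i l))"
    by (rule sum.swap)
  \<comment> \<open>For fixed \<open>j\<close>, the summed sequence is now the row sums of
    \<open>u\<close> up to \<open>j\<close>; the boundary coefficient
    \<open>b (p + 1) j - b (p + 1) (j + 1)\<close> is zero.\<close>
  also have "\<dots> = (\<Sum>j=1..q. \<Sum>i=1..p.
      ((b i j - b i (j + 1)) - (b (i + 1) j - b (i + 1) (j + 1))) * (\<Sum>k=1..i. \<Sum>l=1..j. u k l))"
    using assms(1) by (subst sum_by_parts) simp
  also have "\<dots> = (\<Sum>i=1..p. \<Sum>j=1..q.
      ((b i j - b i (j + 1)) - (b (i + 1) j - b (i + 1) (j + 1))) * (\<Sum>k=1..i. \<Sum>l=1..j. u k l))"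
    by (rule sum.swap)
  finally show ?thesis
    by (simp add: algebra_simps)
qed

theorem theorem1:
  fixes p q :: nat and a u :: "nat \<Rightarrow> nat \<Rightarrow> real"
  assumes "p \<ge> 1" and "q \<ge> 1"
    and "\<forall>i\<in>{1..p}. \<forall>j\<in>{1..q}. a i j \<ge> 0"
    and "\<forall>i\<in>{1..p}. \<forall>j\<in>{1..q}. (i, j) \<noteq> (p, q) \<longrightarrow> Delta p q a i j \<ge> 0"
    and "\<forall>i\<in>{1..p}. \<forall>j\<in>{1..q}. (\<Sum>k=1..i. \<Sum>l=1..j. u k l) \<ge> 0"
  shows "(\<Sum>i=1..p. \<Sum>j=1..q. a i j * u i j) \<ge> 0"
proof -
  \<comment> \<open>A cut-off from above suffices, since all sums start at index 1.\<close>
  define b where "b i j = (if i \<le> p \<and> j \<le> q then a i j else 0)" for i j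
  have diff_nonneg: "b i j - b (i + 1) j - b i (j + 1) + b (i + 1) (j + 1) \<ge> 0"
    if "i \<in> {1..p}" "j \<in> {1..q}" for i j
  proof (cases "(i, j) = (p, q)")
    case True
    then show ?thesis
      using assms(3) that by (simp add: b_def)
  next
    case False
    then have "Delta p q a i j \<ge> 0"
      using assms(4) that by blast
    \<comment> \<open>On the edge \<open>i = p\<close> or \<open>j = q\<close> the two terms outside
      the rectangle vanish, which leaves the matching edge case of \<open>Delta\<close>.\<close>
    moreover have "b i j - b (i + 1) j - b i (j + 1) + b (i + 1) (j + 1) = Delta p q a i j"
      using False that by (auto simp: b_def Delta_def)
    ultimately show ?thesis
      by simp
  qed
  have "(\<Sum>i=1..p. \<Sum>j=1..q. a i j * u i j) = (\<Sum>i=1..p. \<Sum>j=1..q. b i j * u i j)"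
    by (intro sum.cong) (auto simp: b_def)
  also have "\<dots> = (\<Sum>i=1..p. \<Sum>j=1..q.
      (b i j - b (i + 1) j - b i (j + 1) + b (i + 1) (j + 1)) * (\<Sum>k=1..i. \<Sum>l=1..j. u k l))"
    by (rule double_sum_by_parts) (simp_all add: b_def)
  also have "\<dots> \<ge> 0"
  proof (rule sum_nonneg, rule sum_nonneg, rule mult_nonneg_nonneg)
    fix i j
    assume ij: "i \<in> {1..p}" "j \<in> {1..q}"
    show "b i j - b (i + 1) j - b i (j + 1) + b (i + 1) (j + 1) \<ge> 0"
      using ij by (rule diff_nonneg)
    show "(\<Sum>k=1..i. \<Sum>l=1..j. u k l) \<ge> 0"
      using assms(5) ij by blast
  qed
  finally show ?thesis .
qed

end
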